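(* Let $n$ be a positive integer. Then $\mathbb{Q}(\alpha) \neq \mathbb{Q}(\beta)$ holds for all $\alpha, \beta \in I_n^{2,i}$ with $\alpha \neq \beta$.
   Context: For a positive integer $c$, $\sqrt{-c}$ denotes $\sqrt{c}\,\sqrt{-1}$ (the root with positive imaginary part), and likewise $\sqrt{1-4c} = \sqrt{4c-1}\,\sqrt{-1}$. For an integer $n \ge 1$ define $$I_n^{2,i} := \left\{\tfrac{1+\sqrt{1-4c}}{2} \in \mathbb{C}\setminus\mathbb{R} \;\middle|\; c \in \mathbb{Z},\ \left(\tfrac{n-1}{2}\right)^2+1 \le c \le \left(\tfrac{n+1}{2}\right)^2\right\} \quad \text{if } n \text{ is odd},$$ $$I_n^{2,i} := \left\{\sqrt{-c} \in \mathbb{C}\setminus\mathbb{R} \;\middle|\; c \in \mathbb{Z},\ \left(\tfrac{n}{2}\right)^2 < c < \left(\tfrac{n}{2}+1\right)^2\right\} \quad \text{if } n \text{ is even}.$$ $\mathbb{Q}(\alpha)$ denotes the subfield of $\mathbb{C}$ generated by $\alpha$. *)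

theory Defs
  imports Complex_Main "HOL-Algebra.Generated_Fields" "HOL-Algebra.Algebraic_Closure_Type"
begin

text \<open>
  The subfield of the complex numbers generated by \<open>\<alpha>\<close>. Every subfield of \<open>\<complex>\<close> contains the
  rationals, so the prime field need not be added to the generators.
\<close>
definition Q_adjoin :: "complex \<Rightarrow> complex set" where
  "Q_adjoin \<alpha> = generate_field (ring_of_type_algebra :: complex ring) {\<alpha>}"

lemma Q_adjoin_least:
  "subfield (Q_adjoin \<alpha>) (ring_of_type_algebra :: complex ring)"
  "\<alpha> \<in> Q_adjoin \<alpha>"
  "subfield K (ring_of_type_algebra :: complex ring) \<Longrightarrow> \<alpha> \<in> K \<Longrightarrow> Q_adjoin \<alpha> \<subseteq> K"
proof -
  interpret field "ring_of_type_algebra :: complex ring"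
    by (rule field_from_type_algebra)
  have c: "{\<alpha>} \<subseteq> carrier (ring_of_type_algebra :: complex ring)"
    by (simp add: ring_of_type_algebra_def)
  show "subfield (Q_adjoin \<alpha>) (ring_of_type_algebra :: complex ring)"
    unfolding Q_adjoin_def by (rule generate_field_is_subfield[OF c])
  show "\<alpha> \<in> Q_adjoin \<alpha>"
    unfolding Q_adjoin_def by (simp add: generate_field.incl)
  show "subfield K (ring_of_type_algebra :: complex ring) \<Longrightarrow> \<alpha> \<in> K \<Longrightarrow> Q_adjoin \<alpha> \<subseteq> K"
    unfolding Q_adjoin_def by (rule generate_field_min_subfield1[OF c]) auto
qed

text \<open>
  On negative reals the principal branch \<^const>\<open>csqrt\<close> is the root with positive imaginary part.
\<close>
lemma csqrt_minus_of_int: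
  "c > 0 \<Longrightarrow> csqrt (- of_int c) = of_real (sqrt (of_int c)) * \<i>"
  "c > 0 \<Longrightarrow> csqrt (1 - 4 * of_int c) = of_real (sqrt (4 * of_int c - 1)) * \<i>"
  by simp_all

definition I2i :: "nat \<Rightarrow> complex set" where
  "I2i n =
    (if odd n then
       {z. z \<notin> \<real> \<and> (\<exists>c::int. z = (1 + csqrt (1 - 4 * of_int c)) / 2 \<and>
          ((real n - 1) / 2)\<^sup>2 + 1 \<le> real_of_int c \<and> real_of_int c \<le> ((real n + 1) / 2)\<^sup>2)}
     else
       {z. z \<notin> \<real> \<and> (\<exists>c::int. z = csqrt (- of_int c) \<and>
          (real n / 2)\<^sup>2 < real_of_int c \<and> real_of_int c < (real n / 2 + 1)\<^sup>2)})"

end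

(* If \<alpha> and \<beta> generate the same field, the product of their imaginary parts is rational. For two
   radicands a \<noteq> b this forces sqrt a * sqrt b to be an integer m, and then
   (sqrt a - sqrt b)^2 = a + b - 2m is a positive integer. The bounds on c put sqrt a and sqrt b in an
   open interval of length 1 for even n, so the square is less than 1. For odd n the radicands are
   4c - 1 and the interval has length 2; the square is less than 4, yet it is divisible by 4
   because m is odd. *)

theory Submission
  imports Defs
begin

text \<open>Writing \<open>x\<close> as \<open>a / b\<close> in lowest terms, integrality of the
  square makes \<open>b\<^sup>2\<close> divide \<open>a\<^sup>2\<close>, hence \<open>b\<close>
  divide \<open>a\<close>; coprimality then leaves only \<open>b = 1\<close>.\<close>

lemma Ints_of_Rats_square:
  fixes x :: real
  assumes "x \<in> \<rat>" and "x\<^sup>2 \<in> \<int>"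
  shows "x \<in> \<int>"
proof -
  from assms(2) obtain N :: int where N: "x\<^sup>2 = of_int N"
    by (auto elim: Ints_cases)
  from assms(1) obtain q :: rat where q: "x = of_rat q"
    by (auto elim: Rats_cases)
  obtain a b :: int where ab: "quotient_of q = (a, b)" by fastforce
  have b: "b > 0" and cop: "coprime a b" and qe: "q = of_int a / of_int b"
    using ab by (auto simp: quotient_of_denom_pos quotient_of_coprime quotient_of_div)
  have "x = of_int a / of_int b"
    by (simp add: q qe of_rat_divide)
  with N b have "of_int (a\<^sup>2) = (of_int (N * b\<^sup>2) :: real)"
    by (simp add: field_simps)
  then have "a\<^sup>2 = N * b\<^sup>2"
    by (simp only: of_int_eq_iff)
  then have "b\<^sup>2 dvd a\<^sup>2"
    by simp
  then have "b dvd a"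
    by simp
  with cop have "is_unit b"
    by (meson coprime_common_divisor dvd_refl)
  with b have "b = 1"
    by simp
  with \<open>x = of_int a / of_int b\<close> show ?thesis
    by simp
qed

text \<open>This set is the quadratic field \<rat> + \<rat> s\<i>, described by coordinates so that
  membership is checked componentwise. Products stay inside because \<open>Im z * Im w\<close> is a
  rational multiple of \<open>s\<^sup>2\<close>.\<close>

lemma subfield_complex_Rats_quadratic:
  fixes s :: real
  assumes "s \<noteq> 0" and "s\<^sup>2 \<in> \<rat>"
  shows "subfield {z. Re z \<in> \<rat> \<and> Im z / s \<in> \<rat>} (ring_of_type_algebra :: complex ring)"
    (is "subfield ?K ?R")
proof -
  interpret field ?R
    by (rule field_from_type_algebra)
  have R [simp]: "carrier ?R = UNIV" "\<one>\<^bsub>?R\<^esub> = 1" "\<zero>\<^bsub>?R\<^esub> = 0" "x \<otimes>\<^bsub>?R\<^esub> y = x * y" "x \<oplus>\<^bsub>?R\<^esub> y = x + y" for x y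
    by (simp_all add: ring_of_type_algebra_def)
  have neg: "\<ominus>\<^bsub>?R\<^esub> x = - x" for x
    by (rule minus_equality) simp_all
  have inv: "inv\<^bsub>?R\<^esub> x = inverse x" if "x \<noteq> 0" for x
    by (rule comm_inv_char) (use that in simp_all)
  have Im_mult: "Im z * Im w \<in> \<rat>" if "z \<in> ?K" "w \<in> ?K" for z w
  proof -
    have "Im z * Im w = (Im z / s) * (Im w / s) * s\<^sup>2"
      using assms(1) by (simp add: power2_eq_square)
    also have "\<dots> \<in> \<rat>"
      using that assms(2) by (intro Rats_mult) simp_all
    finally show ?thesis .
  qed
  show ?thesis
  proof (rule subfieldI')
    show "subring ?K ?R"
    proof (rule subringI)
      fix z w assume "z \<in> ?K" "w \<in> ?K"
      moreover from this have "Im z * Im w \<in> \<rat>"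
        by (rule Im_mult)
      moreover
      have "Im (z * w) / s = Re z * (Im w / s) + (Im z / s) * Re w"
        by (simp add: add_divide_distrib)
      then have "Im (z * w) / s \<in> \<rat>"
        using \<open>z \<in> ?K\<close> \<open>w \<in> ?K\<close> by (simp del: times_complex.simps times_divide_eq_right times_divide_eq_left)
      ultimately show "z \<otimes>\<^bsub>?R\<^esub> w \<in> ?K"
        by simp
    qed (auto simp: neg add_divide_distrib)
  next
    fix z assume z: "z \<in> ?K - {\<zero>\<^bsub>?R\<^esub>}"
    \<comment> \<open>\<open>N\<close> is the norm of \<open>z\<close>, and the inverse of
      \<open>z\<close> is its conjugate divided by \<open>N\<close>.\<close>
    define N where "N = (Re z)\<^sup>2 + (Im z)\<^sup>2"
    have "N \<in> \<rat>"
      using z Im_mult[of z z] by (simp add: N_def power2_eq_square)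
    moreover have "Im (inverse z) / s = - (Im z / s) / N"
      by (simp add: N_def)
    moreover have "Re (inverse z) = Re z / N"
      by (simp add: N_def)
    ultimately show "inv\<^bsub>?R\<^esub> z \<in> ?K"
      using z by (simp add: inv del: inverse_complex.simps divide_divide_eq_left)
  qed
qed

text \<open>The quadratic field with \<open>s = Im \<alpha>\<close> contains \<alpha>, hence the
  common field, hence \<beta>. So \<open>Im \<beta>\<close> is a rational multiple of
  \<open>Im \<alpha>\<close>, and multiplying the ratio by the rational
  \<open>(Im \<alpha>)\<^sup>2\<close> gives the product.\<close>

lemma Q_adjoin_eq_imp_Im_mult_Rats:
  assumes "Q_adjoin \<alpha> = Q_adjoin \<beta>"
    and "Re \<alpha> \<in> \<rat>" and "(Im \<alpha>)\<^sup>2 \<in> \<rat>"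
  shows "Im \<alpha> * Im \<beta> \<in> \<rat>"
proof (cases "Im \<alpha> = 0")
  case False
  have "Q_adjoin \<alpha> \<subseteq> {z. Re z \<in> \<rat> \<and> Im z / Im \<alpha> \<in> \<rat>}"
    using False assms(2,3)
    by (intro Q_adjoin_least(3) subfield_complex_Rats_quadratic) auto
  then have "Im \<beta> / Im \<alpha> \<in> \<rat>"
    using Q_adjoin_least(2)[of \<beta>] assms(1) by auto
  then have "(Im \<beta> / Im \<alpha>) * (Im \<alpha>)\<^sup>2 \<in> \<rat>"
    using assms(3) by (rule Rats_mult)
  then show ?thesis
    using False by (simp add: power2_eq_square mult.commute)
qed simp

text \<open>The integer \<open>m\<close> is \<open>sqrt a * sqrt b\<close> itself. The equation
  \<open>m\<^sup>2 = a * b\<close> is exported for the parity argument in the case of odd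
  \<open>n\<close>.\<close>

lemma sqrt_diff_square_Ints:
  fixes a b :: int
  assumes "a > 0" "b > 0" "a \<noteq> b" and "sqrt a * sqrt b \<in> \<rat>"
  obtains m :: int where "m\<^sup>2 = a * b" "a + b - 2 * m > 0" "(sqrt a - sqrt b)\<^sup>2 = a + b - 2 * m"
proof -
  have sq: "(sqrt a * sqrt b)\<^sup>2 = of_int (a * b)"
    using assms by (simp add: power_mult_distrib)
  then have "(sqrt a * sqrt b)\<^sup>2 \<in> \<int>"
    by (metis Ints_of_int)
  with assms(4) have "sqrt a * sqrt b \<in> \<int>"
    by (rule Ints_of_Rats_square)
  then obtain m :: int where m: "sqrt a * sqrt b = m"
    by (auto elim: Ints_cases)
  show thesis
  proof (rule that[of m])
    have "real_of_int (m\<^sup>2) = of_int (a * b)"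
      using sq m by simp
    then show "m\<^sup>2 = a * b"
      by (simp only: of_int_eq_iff)
    show eq: "(sqrt a - sqrt b)\<^sup>2 = a + b - 2 * m"
      using assms m by (simp add: power2_diff)
    have "(sqrt a - sqrt b)\<^sup>2 > 0"
      using assms by simp
    with eq show "a + b - 2 * m > 0"
      by linarith
  qed
qed

lemma power2_diff_less:
  fixes x y :: real
  assumes "l < x" "x < l + d" "l < y" "y < l + d"
  shows "(x - y)\<^sup>2 < d\<^sup>2"
proof -
  have "\<bar>x - y\<bar> < \<bar>d\<bar>"
    using assms by linarith
  then show ?thesis
    by (simp add: power2_strict_mono)
qed

text \<open>The case \<open>n = 2 * k\<close>: the generators are purely imaginary, with imaginary
  parts \<open>sqrt a\<close> and \<open>sqrt b\<close>.\<close>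

lemma Q_adjoin_csqrt_neq:
  fixes a b :: int and k :: nat
  assumes "(real k)\<^sup>2 < a" "a < (real k + 1)\<^sup>2" "(real k)\<^sup>2 < b" "b < (real k + 1)\<^sup>2" "a \<noteq> b"
  shows "Q_adjoin (csqrt (- of_int a)) \<noteq> Q_adjoin (csqrt (- of_int b))"
proof
  assume eq: "Q_adjoin (csqrt (- of_int a)) = Q_adjoin (csqrt (- of_int b))"
  have pos: "a > 0" "b > 0"
    using assms(1,3) zero_le_power2[of "real k"] by linarith+
  have "sqrt a * sqrt b \<in> \<rat>"
    using Q_adjoin_eq_imp_Im_mult_Rats[OF eq] pos
    by (simp add: csqrt_minus_of_int)
  then obtain m where m: "a + b - 2 * m > 0" "(sqrt a - sqrt b)\<^sup>2 = a + b - 2 * m"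
    using sqrt_diff_square_Ints pos assms(5) by metis
  \<comment> \<open>Both roots lie strictly between \<open>k\<close> and
    \<open>k + 1\<close>.\<close>
  have "(sqrt a - sqrt b)\<^sup>2 < 1\<^sup>2"
    by (rule power2_diff_less[of "real k"])
       (use assms in \<open>auto intro!: real_less_rsqrt real_less_lsqrt\<close>)
  with m show False
    by simp
qed

text \<open>The case \<open>n = 2 * k + 1\<close>: the imaginary parts are half the roots of
  \<open>A\<close> and \<open>B\<close>, so four times their product is
  \<open>sqrt A * sqrt B\<close>.\<close>

lemma Q_adjoin_half_csqrt_neq:
  fixes a b :: int and k :: nat
  assumes "(real k)\<^sup>2 + 1 \<le> a" "a \<le> (real k + 1)\<^sup>2" "(real k)\<^sup>2 + 1 \<le> b" "b \<le> (real k + 1)\<^sup>2" "a \<noteq> b"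
  shows "Q_adjoin ((1 + csqrt (1 - 4 * of_int a)) / 2) \<noteq> Q_adjoin ((1 + csqrt (1 - 4 * of_int b)) / 2)"
proof
  assume eq: "Q_adjoin ((1 + csqrt (1 - 4 * of_int a)) / 2) = Q_adjoin ((1 + csqrt (1 - 4 * of_int b)) / 2)"
  define A B where "A = 4 * a - 1" and "B = 4 * b - 1"
  have pos: "a > 0" "b > 0"
    using assms(1,3) zero_le_power2[of "real k"] by linarith+
  then have AB: "A > 0" "B > 0" "A \<noteq> B"
    using assms(5) by (simp_all add: A_def B_def)
  have Im: "Im ((1 + csqrt (1 - 4 * of_int c)) / 2) = sqrt (4 * c - 1) / 2"
    and Re: "Re ((1 + csqrt (1 - 4 * of_int c)) / 2) = 1 / 2" if "c > 0" for c :: int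
    using that by (simp_all add: csqrt_minus_of_int)
  have "sqrt A / 2 * (sqrt B / 2) \<in> \<rat>"
    using Q_adjoin_eq_imp_Im_mult_Rats[OF eq] pos unfolding Im[OF pos(1)] Im[OF pos(2)] Re[OF pos(1)]
    by (simp add: A_def B_def power_divide)
  then have "sqrt A / 2 * (sqrt B / 2) * 4 \<in> \<rat>"
    by (rule Rats_mult) simp
  then have "sqrt A * sqrt B \<in> \<rat>"
    by simp
  then obtain m where m: "m\<^sup>2 = A * B" "A + B - 2 * m > 0" "(sqrt A - sqrt B)\<^sup>2 = A + B - 2 * m"
    using sqrt_diff_square_Ints AB by metis
  \<comment> \<open>\<open>A\<close> and \<open>B\<close> are both -1 modulo 4, so their product is
    odd.\<close>
  have "odd (m\<^sup>2)"
    unfolding m(1) by (simp add: A_def B_def)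
  then have "odd m"
    by simp
  then obtain j where "m = 2 * j + 1"
    by (rule oddE)
  \<comment> \<open>The constant -2 from \<open>A + B\<close> and the -2 from \<open>- 2 * m\<close>
    add up to -4; a positive multiple of 4 is at least 4.\<close>
  then have "A + B - 2 * m = 4 * (a + b - 1 - j)"
    by (simp add: A_def B_def)
  with m(2) have "A + B - 2 * m \<ge> 4"
    by presburger
  \<comment> \<open>The bounds on \<open>c\<close> give 4k^2 + 3 \<le> 4c - 1 \<le> 4(k + 1)^2 - 1,
    so both roots lie strictly between 2k and 2k + 2.\<close>
  moreover have "(sqrt A - sqrt B)\<^sup>2 < 2\<^sup>2"
    by (rule power2_diff_less[of "2 * real k"])
       (use assms in \<open>auto intro!: real_less_rsqrt real_less_lsqrt simp: A_def B_def power2_eq_square algebra_simps\<close>)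
  ultimately show False
    using m(3) by simp
qed

theorem theorem7:
  fixes n :: nat
  assumes "n \<ge> 1"
  shows "\<forall>\<alpha>\<in>I2i n. \<forall>\<beta>\<in>I2i n. \<alpha> \<noteq> \<beta> \<longrightarrow> Q_adjoin \<alpha> \<noteq> Q_adjoin \<beta>"
proof (cases "odd n")
  case True
  then obtain k where "n = 2 * k + 1"
    by (rule oddE)
  then have "(real n - 1) / 2 = real k" "(real n + 1) / 2 = real k + 1"
    by simp_all
  then have "I2i n = {z. z \<notin> \<real> \<and> (\<exists>c::int. z = (1 + csqrt (1 - 4 * of_int c)) / 2 \<and>
      (real k)\<^sup>2 + 1 \<le> c \<and> c \<le> (real k + 1)\<^sup>2)}"
    using True by (simp only: I2i_def not_False_eq_True if_True)
  then show ?thesis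
    \<comment> \<open>The two radicands differ because equal ones would give the same
      element.\<close>
    by (simp only:) (safe, rule notE[OF Q_adjoin_half_csqrt_neq[of k]], assumption+, auto)
next
  case False
  then obtain k where "n = 2 * k"
    by (auto elim: evenE)
  then have "real n / 2 = real k"
    by simp
  then have "I2i n = {z. z \<notin> \<real> \<and> (\<exists>c::int. z = csqrt (- of_int c) \<and>
      (real k)\<^sup>2 < c \<and> c < (real k + 1)\<^sup>2)}"
    using False by (simp only: I2i_def if_False)
  then show ?thesis
    by (simp only:) (safe, rule notE[OF Q_adjoin_csqrt_neq[of k]], assumption+, auto)
qed

end
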